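(* For every natural number $\Delta$ and every $0<p<1$ there exists a constant $C$ such that, for any $\Delta$-bounded edge-coloring $c$ of the complete graph $K_N$, the clique number of the random entangled graph $G_c(p)$ is at most $C\log N\log\log N$ with probability tending to $1$ as $N\to\infty$.
   Context: Given an edge-coloring $c$ of $K_N$, an entangled graph with respect to $c$ is the spanning subgraph of $K_N$ whose edge set is the union of all edges whose color lies in some chosen set $S$ of colors. The coloring is $\Delta$-bounded if each color class (as a graph) has maximum degree at most $\Delta$. The random entangled graph $G_c(p)$ is obtained by including each color in $S$ independently with probability $p$. *)

theory Defs
  imports "HOL-Probability.Probability" "HOL-Library.Ramsey"
begin

text \<open>
  Graphs on the vertex set \<open>{..<N}\<close> are represented by their sets of edges; the edge set
  of \<open>K\<^sub>N\<close> is \<open>[{..<N}]\<^bsup>2\<^esup>\<close>. An edge-coloring is a total function on vertex sets of which only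
  the values on these edges matter.
\<close>

definition degree :: "nat set set \<Rightarrow> nat \<Rightarrow> nat" where
  "degree E v = card {e \<in> E. v \<in> e}"

definition clique_number :: "nat \<Rightarrow> nat set set \<Rightarrow> nat" where
  "clique_number N E = Max {card K | K. K \<subseteq> {..<N} \<and> clique K E}"

definition color_class :: "nat \<Rightarrow> (nat set \<Rightarrow> 'c) \<Rightarrow> 'c \<Rightarrow> nat set set" where
  "color_class N c x = {e \<in> [{..<N}]\<^bsup>2\<^esup>. c e = x}"

definition bounded_coloring :: "nat \<Rightarrow> nat \<Rightarrow> (nat set \<Rightarrow> 'c) \<Rightarrow> bool" where
  "bounded_coloring \<Delta> N c \<longleftrightarrow> (\<forall>x. \<forall>v<N. degree (color_class N c x) v \<le> \<Delta>)"

definition entangled_graph :: "nat \<Rightarrow> (nat set \<Rightarrow> 'c) \<Rightarrow> 'c set \<Rightarrow> nat set set" where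
  "entangled_graph N c S = (\<Union>x\<in>S. color_class N c x)"

text \<open>
  Only the colors that occur on an edge are sampled: there are finitely many of them, and the
  others do not affect the graph.
\<close>

definition random_entangled_graph ::
  "nat \<Rightarrow> (nat set \<Rightarrow> 'c) \<Rightarrow> real \<Rightarrow> nat set set pmf" where
  "random_entangled_graph N c p =
     map_pmf (\<lambda>b. entangled_graph N c {x. b x})
       (Pi_pmf (c ` [{..<N}]\<^bsup>2\<^esup>) False (\<lambda>_. bernoulli_pmf p))"

end

theory Submission
  imports Defs "HOL-Real_Asymp.Real_Asymp"
begin

text \<open>
  Every vertex set \<open>A\<close> of size \<open>n\<close> of order \<open>log N log log N\<close> contains a subset \<open>X\<close> spanning some
  number \<open>t\<close>, of order at least \<open>n\<close>, of colors and lying in a family of at most \<open>exp (\<eta> t)\<close> sets,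
  with \<open>\<eta>\<close> as small as we like; a union bound over these families finishes the proof.

  To find \<open>X\<close>, build \<open>B \<subseteq> A\<close> vertex by vertex. A new vertex joined to \<open>B\<close> by an edge of a color
  already seen in \<open>B\<close> is one of polynomially many in \<open>n\<close>; only the other ones (seeds) cost a factor
  \<open>N\<close>. While the vertices of \<open>A\<close> derivable in this way are fewer than \<open>2|B|\<close>, Cauchy-Schwarz applied
  to the color classes between \<open>B\<close> and the rest of \<open>A\<close> yields a seed that multiplies the number of
  derivable vertices by \<open>1 + \<Omega>(n/k)\<close>, where \<open>k\<close> is the number of colors of \<open>A\<close>. Hence \<open>O((k/n) log n)\<close>
  seeds suffice to reach \<open>|B|\<close> of order \<open>n / log n\<close>. From then on a vertex with at least half of its edges
  to \<open>B\<close> in new colors contributes enough colors to pay for itself. Once there are no more of these,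
  double counting puts \<open>A - B\<close> into a set, determined by \<open>B\<close>, of size linear in the number of colors
  of \<open>B\<close>. Take \<open>X = B\<close> if \<open>k/n\<close> is bounded; otherwise specify all of \<open>A\<close> and take \<open>X = A\<close>.
\<close>

section \<open>Counting and logarithm estimates\<close>

lemma card_le_mult_card_image:
  assumes "finite S" and "\<And>y. y \<in> f ` S \<Longrightarrow> card {x \<in> S. f x = y} \<le> k"
  shows "card S \<le> k * card (f ` S)"
proof -
  have "card S = (\<Sum>y\<in>f ` S. card {x \<in> S. f x = y})"
    using sum.image_gen[OF assms(1), of "\<lambda>_. 1::nat" f] by simp
  also have "\<dots> \<le> (\<Sum>y\<in>f ` S. k)"
    by (intro sum_mono assms(2))
  finally show ?thesis by (simp add: mult.commute)
qed

text \<open>Adding up, over all points, the size of the point's own fibre gives the sum of the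
  squared fibre sizes, so this is Cauchy-Schwarz against the constant 1. It makes few colors force
  many pairs of edges of equal color.\<close>

lemma card_power2_le_sum_card_fibres:
  assumes "finite P"
  shows "(card P)\<^sup>2 \<le> card (f ` P) * (\<Sum>p\<in>P. card {q \<in> P. f q = f p})"
proof -
  define e where "e y = card {q \<in> P. f q = y}" for y
  have P: "card P = (\<Sum>y\<in>f ` P. e y)"
    using sum.image_gen[OF assms(1), of "\<lambda>_. 1::nat" f] by (simp add: e_def)
  have "(\<Sum>p\<in>P. e (f p)) = (\<Sum>y\<in>f ` P. \<Sum>p\<in>{p \<in> P. f p = y}. e (f p))"
    by (rule sum.image_gen[OF assms])
  also have "\<dots> = (\<Sum>y\<in>f ` P. (e y)\<^sup>2)"
    by (intro sum.cong refl) (simp add: e_def power2_eq_square)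
  finally have Q: "(\<Sum>p\<in>P. e (f p)) = (\<Sum>y\<in>f ` P. (e y)\<^sup>2)" .
  have "(\<Sum>y\<in>f ` P. real (e y) * 1)\<^sup>2 \<le> (\<Sum>y\<in>f ` P. (real (e y))\<^sup>2) * (\<Sum>y\<in>f ` P. 1\<^sup>2)"
    by (rule Cauchy_Schwarz_ineq_sum)
  then have "real ((\<Sum>y\<in>f ` P. e y)\<^sup>2) \<le> real ((\<Sum>y\<in>f ` P. (e y)\<^sup>2) * card (f ` P))"
    by simp
  then have "(\<Sum>y\<in>f ` P. e y)\<^sup>2 \<le> (\<Sum>y\<in>f ` P. (e y)\<^sup>2) * card (f ` P)"
    by (simp only: of_nat_le_iff)
  then show ?thesis
    using P Q by (simp add: e_def mult.commute)
qed

lemma card_UN_insert_le: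
  assumes "finite F" and "\<And>B. B \<in> F \<Longrightarrow> finite (D B) \<and> card (D B) \<le> k"
  shows "card (\<Union>B\<in>F. (\<lambda>v. insert v B) ` D B) \<le> k * card F"
proof -
  have "card (\<Union>B\<in>F. (\<lambda>v. insert v B) ` D B) \<le> (\<Sum>B\<in>F. card ((\<lambda>v. insert v B) ` D B))"
    by (rule card_UN_le[OF assms(1)])
  also have "\<dots> \<le> (\<Sum>B\<in>F. k)"
    using assms(2) by (intro sum_mono) (meson card_image_le order_trans)
  finally show ?thesis by (simp add: mult.commute)
qed

text \<open>Generating function bound: since \<open>x <= 1\<close>, every counted \<open>F\<close>
  has weight \<open>x ^ card F >= x ^ n\<close>, and over \<open>Pow W\<close> these weights sum to
  \<open>(1 + x) ^ card W\<close>. The free \<open>x\<close> is tuned in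
  \<open>card_completions_le\<close>.\<close>

lemma card_bounded_subsets_le:
  fixes x :: real
  assumes "finite W" and x: "0 < x" "x \<le> 1"
  shows "card {F. F \<subseteq> W \<and> card F \<le> n} * x ^ n \<le> exp (x * card W)"
proof -
  have "card {F. F \<subseteq> W \<and> card F \<le> n} * x ^ n = (\<Sum>F\<in>{F. F \<subseteq> W \<and> card F \<le> n}. x ^ n)"
    by simp
  also have "\<dots> \<le> (\<Sum>F\<in>{F. F \<subseteq> W \<and> card F \<le> n}. x ^ card F)"
    using x by (intro sum_mono power_decreasing) auto
  also have "\<dots> \<le> (\<Sum>F\<in>Pow W. x ^ card F)"
    using assms by (intro sum_mono2) auto
  also have "\<dots> = (\<Prod>w\<in>W. x + 1)"
    using prod_add[OF assms(1), of "\<lambda>_. x" "\<lambda>_. 1"] by simp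
  also have "\<dots> \<le> exp x ^ card W"
    using x exp_ge_add_one_self[of x] by (simp add: add.commute power_mono)
  also have "\<dots> = exp (x * card W)"
    by (simp add: exp_of_nat_mult[symmetric] mult.commute)
  finally show ?thesis .
qed

text \<open>Limits the number \<open>s\<close> of seeds that each multiply a bounded quantity by
  \<open>1 + \<theta>\<close>. For \<open>\<theta> <= 1/2\<close> the quadratic error in the
  logarithm costs at most half of \<open>\<theta>\<close>.\<close>

lemma power_le_imp_mult_le_ln:
  fixes \<theta> y :: real
  assumes "0 \<le> \<theta>" "\<theta> \<le> 1/2" "(1 + \<theta>) ^ s \<le> y"
  shows "s * \<theta> \<le> 2 * ln y"
proof -
  have "\<theta> * \<theta> \<le> 1/2 * \<theta>"
    using assms by (intro mult_right_mono) auto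
  then have "\<theta> / 2 \<le> ln (1 + \<theta>)"
    using ln_one_plus_pos_lower_bound[of \<theta>] assms by (simp add: power2_eq_square)
  then have "s * (\<theta> / 2) \<le> s * ln (1 + \<theta>)"
    by (intro mult_left_mono) auto
  also have "\<dots> = ln ((1 + \<theta>) ^ s)"
    using assms by (simp add: ln_realpow)
  also have "\<dots> \<le> ln y"
    using assms by (subst ln_le_cancel_iff) (auto intro: less_le_trans[of 0 "(1 + \<theta>) ^ s"])
  finally show ?thesis by simp
qed

section \<open>Colors spanned by a vertex set\<close>

locale bounded_edge_coloring =
  fixes N \<Delta> :: nat and c :: "nat set \<Rightarrow> 'c"
  assumes bounded: "bounded_coloring \<Delta> N c" and Delta_pos: "1 \<le> \<Delta>"
begin

lemma card_color_neighbours_le: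
  assumes "v < N"
  shows "card {w. w < N \<and> w \<noteq> v \<and> c {v, w} = x} \<le> \<Delta>"
proof -
  have "card {w. w < N \<and> w \<noteq> v \<and> c {v, w} = x} \<le> card {e \<in> color_class N c x. v \<in> e}"
  proof (rule card_inj_on_le[where f = "\<lambda>w. {v, w}"])
    show "inj_on (\<lambda>w. {v, w}) {w. w < N \<and> w \<noteq> v \<and> c {v, w} = x}"
      by (auto simp: inj_on_def doubleton_eq_iff)
    show "(\<lambda>w. {v, w}) ` {w. w < N \<and> w \<noteq> v \<and> c {v, w} = x} \<subseteq> {e \<in> color_class N c x. v \<in> e}"
      using assms by (auto simp: color_class_def)
    show "finite {e \<in> color_class N c x. v \<in> e}"
      by (rule finite_subset[of _ "[{..<N}]\<^bsup>2\<^esup>"]) (auto simp: color_class_def finite_imp_finite_nsets)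
  qed
  also have "\<dots> \<le> \<Delta>"
    using bounded assms by (auto simp: bounded_coloring_def degree_def)
  finally show ?thesis .
qed

lemma card_color_neighbours_in_le:
  assumes "v < N" and "X \<subseteq> {..<N} - {v}"
  shows "card {w \<in> X. c {v, w} = x} \<le> \<Delta>" and "card {w \<in> X. c {w, v} = x} \<le> \<Delta>"
proof -
  have "card {w \<in> X. c {v, w} = x} \<le> card {w. w < N \<and> w \<noteq> v \<and> c {v, w} = x}"
    using assms(2) by (intro card_mono) auto
  then show "card {w \<in> X. c {v, w} = x} \<le> \<Delta>"
    using card_color_neighbours_le[OF assms(1)] order_trans by blast
  then show "card {w \<in> X. c {w, v} = x} \<le> \<Delta>"
    by (simp add: insert_commute)
qed

definition colors :: "nat set \<Rightarrow> 'c set" where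
  "colors X = c ` [X]\<^bsup>2\<^esup>"

lemma colors_mono: "X \<subseteq> Y \<Longrightarrow> colors X \<subseteq> colors Y"
  unfolding colors_def by (intro image_mono nsets_mono)

lemma finite_colors: "finite X \<Longrightarrow> finite (colors X)"
  by (simp add: colors_def finite_imp_finite_nsets)

lemma color_in_colors: "\<lbrakk>u \<in> X; v \<in> X; u \<noteq> v\<rbrakk> \<Longrightarrow> c {u, v} \<in> colors X"
  unfolding colors_def by (intro imageI) simp

lemma card_colors_le: "finite X \<Longrightarrow> card (colors X) \<le> (card X)\<^sup>2"
proof -
  assume X: "finite X"
  have "card (colors X) \<le> card ([X]\<^bsup>2\<^esup>)"
    unfolding colors_def by (intro card_image_le finite_imp_finite_nsets X)
  also have "\<dots> = card X choose 2" by (rule card_nsets)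
  also have "\<dots> \<le> (card X)\<^sup>2"
    by (cases "2 \<le> card X") (auto intro: binomial_le_pow simp: binomial_eq_0)
  finally show ?thesis .
qed

text \<open>The edges at a single vertex of \<open>X\<close> already suffice, because each color
  occurs on at most \<open>\<Delta>\<close> of them; the summand 1 is that vertex.\<close>

lemma card_le_card_colors:
  assumes "X \<subseteq> {..<N}"
  shows "card X \<le> \<Delta> * card (colors X) + 1"
proof (cases "X = {}")
  case False
  then obtain v where v: "v \<in> X" by blast
  have fin: "finite X" using assms finite_subset by blast
  have "card (X - {v}) \<le> \<Delta> * card ((\<lambda>w. c {v, w}) ` (X - {v}))"
    using assms v fin
    by (intro card_le_mult_card_image card_color_neighbours_in_le) auto
  also have "\<dots> \<le> \<Delta> * card (colors X)"
    using v fin by (intro mult_le_mono2 card_mono finite_colors) (auto intro: color_in_colors)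
  finally show ?thesis using v fin by simp
qed auto

section \<open>Old and new edges from an outside vertex\<close>

definition old :: "nat set \<Rightarrow> nat \<Rightarrow> nat set" where
  "old B w = {v \<in> B. c {v, w} \<in> colors B}"

text \<open>The edges from \<open>w\<close> to \<open>B - old B w\<close> avoid
  \<open>colors B\<close>, and at \<open>w\<close> each color is used at most
  \<open>\<Delta>\<close> times. The additive form avoids truncated subtraction.\<close>

lemma card_new_colors:
  assumes "B \<subseteq> {..<N}" and "w < N" and "w \<notin> B"
  shows "card (B - old B w) + \<Delta> * card (colors B) \<le> \<Delta> * card (colors (insert w B))"
proof -
  have fin: "finite B" using assms finite_subset by blast
  let ?Y = "(\<lambda>v. c {v, w}) ` (B - old B w)"
  have new: "card (B - old B w) \<le> \<Delta> * card ?Y"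
    using assms fin
    by (intro card_le_mult_card_image card_color_neighbours_in_le) auto
  have "card ?Y + card (colors B) = card (?Y \<union> colors B)"
    using fin by (intro card_Un_disjoint[symmetric] finite_colors) (auto simp: old_def)
  moreover have "card (?Y \<union> colors B) \<le> card (colors (insert w B))"
  proof (intro card_mono finite_colors)
    show "?Y \<union> colors B \<subseteq> colors (insert w B)"
      using assms(3) colors_mono[of B "insert w B"] color_in_colors[of _ "insert w B" w] by auto
  qed (use fin in simp)
  ultimately have "card ?Y + card (colors B) \<le> card (colors (insert w B))" by simp
  then have "\<Delta> * card ?Y + \<Delta> * card (colors B) \<le> \<Delta> * card (colors (insert w B))"
    by (metis add_mult_distrib2 mult_le_mono2)
  with new show ?thesis by linarith
qed

text \<open>Here and in \<open>half_old\<close> the candidates range over all of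
  \<open>{..<N}\<close>, not over the set \<open>A\<close> to be encoded. They are thus determined
  by \<open>B\<close> alone, and choosing among them is cheap to count.\<close>

definition derived :: "nat set \<Rightarrow> nat set" where
  "derived B = {w. w < N \<and> w \<notin> B \<and> old B w \<noteq> {}}"

definition half_old :: "nat set \<Rightarrow> nat set" where
  "half_old B = {w. w < N \<and> w \<notin> B \<and> card B \<le> 2 * card (old B w)}"

text \<open>Once \<open>v\<close> and the color of the edge are fixed, at most
  \<open>\<Delta>\<close> vertices \<open>w\<close> remain, so sending a pair to its
  \<open>v\<close> and its color has small fibres.\<close>

lemma card_old_pairs:
  assumes "B \<subseteq> {..<N}"
  shows "card (SIGMA w:{..<N} - B. old B w) \<le> \<Delta> * (card B * card (colors B))"
proof -
  have fin: "finite B" using assms finite_subset by blast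
  let ?P = "SIGMA w:{..<N} - B. old B w"
  let ?f = "\<lambda>(w, v). (v, c {v, w})"
  have finP: "finite ?P"
    using fin by (auto simp: old_def)
  have "card ?P \<le> \<Delta> * card (?f ` ?P)"
  proof (rule card_le_mult_card_image[OF finP])
    fix y assume "y \<in> ?f ` ?P"
    then obtain v x where y: "y = (v, x)" "v \<in> B" by (auto simp: old_def)
    have "card {p \<in> ?P. ?f p = y} \<le> card {w \<in> {..<N} - B. c {v, w} = x}"
      by (rule card_inj_on_le[where f = fst]) (auto simp: y inj_on_def)
    also have "\<dots> \<le> \<Delta>"
      using y assms by (intro card_color_neighbours_in_le) auto
    finally show "card {p \<in> ?P. ?f p = y} \<le> \<Delta>" .
  qed
  also have "card (?f ` ?P) \<le> card (B \<times> colors B)"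
    using fin by (intro card_mono finite_cartesian_product finite_colors) (auto simp: old_def)
  finally show ?thesis
    by (simp add: card_cartesian_product)
qed

lemma card_derived_le:
  assumes "B \<subseteq> {..<N}"
  shows "card (derived B) \<le> \<Delta> * (card B) ^ 3"
proof -
  have fin: "finite B" using assms finite_subset by blast
  have "derived B \<subseteq> fst ` (SIGMA w:{..<N} - B. old B w)"
    by (force simp: derived_def)
  then have "card (derived B) \<le> card (SIGMA w:{..<N} - B. old B w)"
    using fin by (intro surj_card_le) (auto simp: old_def)
  also note card_old_pairs[OF assms]
  also have "\<Delta> * (card B * card (colors B)) \<le> \<Delta> * (card B * (card B)\<^sup>2)"
    by (intro mult_le_mono2 card_colors_le fin)
  finally show ?thesis
    by (simp add: power3_eq_cube power2_eq_square mult.assoc)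
qed

text \<open>Each vertex of \<open>half_old B\<close> accounts for at least half of
  \<open>card B\<close> old pairs. The factor \<open>card B\<close> cancels, which leaves a bound
  linear in the number of colors.\<close>

lemma card_half_old_le:
  assumes "B \<subseteq> {..<N}" and "B \<noteq> {}"
  shows "card (half_old B) \<le> 2 * \<Delta> * card (colors B)"
proof -
  have fin: "finite B" using assms finite_subset by blast
  have finh: "finite (half_old B)" by (simp add: half_old_def)
  have "card B * card (half_old B) = (\<Sum>w\<in>half_old B. card B)" by simp
  also have "\<dots> \<le> (\<Sum>w\<in>half_old B. 2 * card (old B w))"
    by (intro sum_mono) (simp add: half_old_def)
  also have "\<dots> = 2 * card (SIGMA w:half_old B. old B w)"
    using finh fin by (subst card_SigmaI) (auto simp: old_def sum_distrib_left)
  also have "card (SIGMA w:half_old B. old B w) \<le> card (SIGMA w:{..<N} - B. old B w)"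
    using fin by (intro card_mono) (auto simp: old_def half_old_def)
  also note card_old_pairs[OF assms(1)]
  finally have "card B * card (half_old B) \<le> card B * (2 * \<Delta> * card (colors B))"
    by (simp add: mult_ac)
  then show ?thesis
    using assms fin by (simp add: card_gt_0_iff)
qed

section \<open>Sets built from seeds and derived vertices\<close>

text \<open>The indices count the seeds and the derived vertices. A seed is allowed to be derivable
  and a set may be reached with several index pairs; this is harmless, since only upper bounds on
  the number of sets are proved.\<close>

inductive reach :: "nat \<Rightarrow> nat \<Rightarrow> nat set \<Rightarrow> bool" where
  empty: "reach 0 0 {}"
| seed: "\<lbrakk>reach s d B; v < N; v \<notin> B\<rbrakk> \<Longrightarrow> reach (Suc s) d (insert v B)"
| deriv: "\<lbrakk>reach s d B; w \<in> derived B\<rbrakk> \<Longrightarrow> reach s (Suc d) (insert w B)"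

lemma reach_subset_card: "reach s d B \<Longrightarrow> B \<subseteq> {..<N} \<and> card B = s + d"
proof (induction rule: reach.induct)
  case (seed s d B v)
  then show ?case using finite_subset[of B "{..<N}"] by auto
next
  case (deriv s d B w)
  then show ?case using finite_subset[of B "{..<N}"] by (auto simp: derived_def)
qed auto

lemma finite_reach: "finite {B. reach s d B}"
  by (rule finite_subset[of _ "Pow {..<N}"]) (use reach_subset_card in auto)

text \<open>Induction on the last step: a seed has at most \<open>N\<close> choices, a derived
  vertex at most \<open>\<Delta> * n ^ 3\<close>. The extra 2 in both bases pays for the two kinds
  of last step, each of which contributes at most half of the bound.\<close>

lemma card_reach_le:
  assumes "s + d \<le> n"
  shows "card {B. reach s d B} \<le> (2 * N) ^ s * (2 * \<Delta> * n ^ 3) ^ d"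
  using assms
proof (induction "s + d" arbitrary: s d)
  case 0
  have "B = {}" if "reach 0 0 B" for B
    using that by cases auto
  then have "{B. reach 0 0 B} = {{}}"
    using reach.empty by blast
  then show ?case using 0 by simp
next
  case (Suc l)
  let ?f = "\<lambda>s d. (2 * N) ^ s * (2 * \<Delta> * n ^ 3) ^ d"
  \<comment> \<open>The case \<open>s = 0\<close> is split off because \<open>s - 1\<close> would
    again be 0 there and admit a seed step that does not exist; likewise for
    \<open>d\<close>.\<close>
  define S where "S = (if s = 0 then {} else
    \<Union>B\<in>{B. reach (s - 1) d B}. (\<lambda>v. insert v B) ` {..<N})"
  define D where "D = (if d = 0 then {} else
    \<Union>B\<in>{B. reach s (d - 1) B}. (\<lambda>v. insert v B) ` derived B)"
  have findv: "finite (derived B)" for B by (simp add: derived_def)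
  have sub: "{B. reach s d B} \<subseteq> S \<union> D"
  proof
    fix B assume "B \<in> {B. reach s d B}"
    then have "reach s d B" by simp
    then show "B \<in> S \<union> D"
    proof cases
      case (seed s' B' v)
      then show ?thesis by (auto simp: S_def)
    next
      case (deriv d' B' w)
      then show ?thesis by (auto simp: D_def)
    qed (use Suc.hyps(2) in simp)
  qed
  have finS: "finite S" "finite D"
    using findv by (auto simp: S_def D_def finite_reach)
  have S: "2 * card S \<le> ?f s d"
  proof (cases s)
    case (Suc s')
    have "card S \<le> N * card {B. reach s' d B}"
      unfolding S_def Suc by (simp, rule card_UN_insert_le) (auto simp: finite_reach)
    also have "\<dots> \<le> N * ?f s' d"
      using Suc.hyps(1)[of s' d] Suc.hyps(2) Suc.prems Suc by (intro mult_le_mono2) simp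
    finally show ?thesis by (simp add: Suc mult_ac)
  qed (simp add: S_def)
  have D: "2 * card D \<le> ?f s d"
  proof (cases d)
    case (Suc d')
    have "card D \<le> (\<Delta> * n ^ 3) * card {B. reach s d' B}"
    proof -
      have "card (derived B) \<le> \<Delta> * n ^ 3" if "reach s d' B" for B
      proof -
        have "card (derived B) \<le> \<Delta> * card B ^ 3"
          using that reach_subset_card card_derived_le by blast
        also have "card B \<le> n"
          using reach_subset_card[OF that] Suc.prems Suc by simp
        finally show ?thesis by (simp add: power_mono)
      qed
      then show ?thesis
        unfolding D_def Suc using findv by (simp, intro card_UN_insert_le) (auto simp: finite_reach)
    qed
    also have "\<dots> \<le> (\<Delta> * n ^ 3) * ?f s d'"
      using Suc.hyps(1)[of s d'] Suc.hyps(2) Suc.prems Suc by (intro mult_le_mono2) simp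
    finally show ?thesis by (simp add: Suc mult_ac)
  qed (simp add: D_def)
  have "card {B. reach s d B} \<le> card (S \<union> D)"
    using sub finS by (intro card_mono) auto
  also have "\<dots> \<le> card S + card D" by (rule card_Un_le)
  finally show ?case using S D by linarith
qed

section \<open>Growing and saturating phases\<close>

text \<open>The potential of the growing phase. A derivation inside \<open>A\<close> is possible
  exactly when this set is larger than \<open>B\<close>.\<close>

definition extent :: "nat set \<Rightarrow> nat set \<Rightarrow> nat set" where
  "extent A B = B \<union> (A \<inter> derived B)"

lemma extent_mono: "\<lbrakk>B \<subseteq> B'; A \<subseteq> {..<N}; B' \<subseteq> A\<rbrakk> \<Longrightarrow> extent A B \<subseteq> extent A B'"
  using colors_mono[of B B'] by (auto simp: extent_def derived_def old_def)

text \<open>Averaging over candidate seeds \<open>u\<close> outside the extent: \<open>S u\<close>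
  collects the pairs in \<open>B \<times> U\<close> whose color also occurs between \<open>u\<close>
  and \<open>B\<close>. With at most \<open>k\<close> colors around, Cauchy-Schwarz makes the
  average of \<open>card (S u)\<close> large, and the endpoints in \<open>U\<close> of these pairs
  join the extent when \<open>u\<close> is added.\<close>

lemma extent_growth:
  assumes A: "A \<subseteq> {..<N}" and B: "B \<subseteq> A" "B \<noteq> {}"
    and k: "card (colors A) \<le> k" "0 < k"
    and ext: "card (extent A B) \<le> 2 * card B" "2 * card (extent A B) \<le> card A"
  obtains u where "u \<in> A - extent A B"
    and "(1 + card A / (4 * \<Delta> * k)) * card (extent A B) \<le> card (extent A (insert u B))"
proof -
  define U where "U = A - extent A B"
  have fin: "finite A" "finite B" "finite U"
    using A B finite_subset[OF A] finite_subset[OF B(1)] by (auto simp: U_def)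
  have extA: "extent A B \<subseteq> A" using B by (auto simp: extent_def)
  have cardU: "card U = card A - card (extent A B)"
    unfolding U_def using extA fin by (intro card_Diff_subset) (auto intro: finite_subset)
  have BU: "B \<inter> U = {}" by (auto simp: U_def extent_def)
  have BN: "B \<subseteq> {..<N}" "U \<subseteq> {..<N}" using A B by (auto simp: U_def)
  define m where "m = card B"
  have mpos: "0 < m" using B fin by (simp add: m_def card_gt_0_iff)
  have ext_pos: "0 < card (extent A B)"
    using B fin extA by (auto simp: card_gt_0_iff extent_def intro: finite_subset)
  have Upos: "0 < card U" using cardU ext ext_pos by linarith
  define P where "P = B \<times> U"
  define col where "col = (\<lambda>(v, w). c {v, w})"
  define reach_cols where "reach_cols u = (\<lambda>v. c {v, u}) ` B" for u
  define S where "S u = {p \<in> P. col p \<in> reach_cols u}" for u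
  have finP: "finite P" using fin by (simp add: P_def)
  have cardP: "card P = m * card U" by (simp add: P_def m_def card_cartesian_product)
  have "col ` P \<subseteq> colors A"
    using B BU by (auto simp: col_def P_def U_def extent_def intro!: color_in_colors)
  then have colP: "card (col ` P) \<le> k"
    using card_mono[OF finite_colors[OF fin(1)]] k order_trans by blast
  \<comment> \<open>At an endpoint in \<open>U\<close> the color \<open>x\<close> occurs at most
    \<open>\<Delta>\<close> times, so edges of color \<open>x\<close> can be traded for candidate
    seeds that see \<open>x\<close>.\<close>
  have fib: "card {q \<in> P. col q = x} \<le> \<Delta> * card {u \<in> U. x \<in> reach_cols u}" for x
  proof -
    have "card {q \<in> P. col q = x} \<le> \<Delta> * card (snd ` {q \<in> P. col q = x})"
    proof (rule card_le_mult_card_image)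
      fix w assume "w \<in> snd ` {q \<in> P. col q = x}"
      then have w: "w \<in> U" by (auto simp: P_def)
      have "card {q \<in> {q \<in> P. col q = x}. snd q = w} \<le> card {v \<in> B. c {v, w} = x}"
        using fin by (intro card_inj_on_le[where f = fst]) (auto simp: P_def col_def inj_on_def)
      also have "\<dots> \<le> \<Delta>"
        using w BN BU by (intro card_color_neighbours_in_le) auto
      finally show "card {q \<in> {q \<in> P. col q = x}. snd q = w} \<le> \<Delta>" .
    qed (use finP in simp)
    also have "snd ` {q \<in> P. col q = x} = {u \<in> U. x \<in> reach_cols u}"
      by (force simp: P_def col_def reach_cols_def image_iff)
    finally show ?thesis .
  qed
  have "(m * card U)\<^sup>2 \<le> card (col ` P) * (\<Sum>p\<in>P. card {q \<in> P. col q = col p})"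
    using card_power2_le_sum_card_fibres[OF finP, of col] cardP by simp
  also have "\<dots> \<le> k * (\<Sum>p\<in>P. \<Delta> * card {u \<in> U. col p \<in> reach_cols u})"
    by (intro mult_le_mono colP sum_mono fib)
  also have "(\<Sum>p\<in>P. \<Delta> * card {u \<in> U. col p \<in> reach_cols u}) = \<Delta> * (\<Sum>u\<in>U. card (S u))"
  proof -
    have "(\<Sum>p\<in>P. card {u \<in> U. col p \<in> reach_cols u})
        = (\<Sum>p\<in>P. \<Sum>u\<in>U. if col p \<in> reach_cols u then 1 else 0)"
      using fin by (intro sum.cong refl) (simp add: sum.If_cases Int_def)
    also have "\<dots> = (\<Sum>u\<in>U. \<Sum>p\<in>P. if col p \<in> reach_cols u then 1 else 0)"
      by (rule sum.swap)
    also have "\<dots> = (\<Sum>u\<in>U. card (S u))"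
      using finP by (intro sum.cong refl) (simp add: sum.If_cases Int_def S_def)
    finally show ?thesis by (simp flip: sum_distrib_left)
  qed
  finally have le: "(m * card U)\<^sup>2 \<le> k * (\<Delta> * (\<Sum>u\<in>U. card (S u)))" .
  \<comment> \<open>A maximizer does at least as well as the average.\<close>
  obtain u where u: "u \<in> U" "(\<Sum>u\<in>U. card (S u)) \<le> card U * card (S u)"
  proof -
    have "U \<noteq> {}" using Upos by auto
    then have "Max ((\<lambda>u. card (S u)) ` U) \<in> (\<lambda>u. card (S u)) ` U"
      using fin(3) by (intro Max_in) auto
    then obtain u where "u \<in> U" "Max ((\<lambda>u. card (S u)) ` U) = card (S u)"
      by blast
    moreover have "(\<Sum>u\<in>U. card (S u)) \<le> of_nat (card U) * Max ((\<lambda>u. card (S u)) ` U)"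
      using fin by (intro sum_bounded_above) auto
    ultimately show ?thesis using that by auto
  qed
  \<comment> \<open>Passing from pairs to their endpoints in \<open>U\<close> loses at most the
    number \<open>m\<close> of partners in \<open>B\<close>.\<close>
  have Su: "card (S u) \<le> m * card (snd ` S u)"
  proof (rule card_le_mult_card_image)
    show "finite (S u)" using finP by (simp add: S_def)
    fix w
    show "card {q \<in> S u. snd q = w} \<le> m"
      unfolding m_def using fin by (intro card_inj_on_le[where f = fst]) (auto simp: S_def P_def inj_on_def)
  qed
  have "(m * card U) * (m * card U) \<le> (m * card U) * (k * \<Delta> * card (snd ` S u))"
  proof -
    have "(m * card U)\<^sup>2 \<le> k * (\<Delta> * (card U * (m * card (snd ` S u))))"
      using le u(2) Su by (meson mult_le_mono2 order_trans)
    then show ?thesis by (simp add: power2_eq_square mult_ac)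
  qed
  then have gain: "m * card U \<le> k * \<Delta> * card (snd ` S u)"
    using mpos Upos by simp
  have uB: "u \<notin> B" using u BU by auto
  have sub: "extent A B \<union> snd ` S u \<subseteq> extent A (insert u B)"
  proof
    fix w assume "w \<in> extent A B \<union> snd ` S u"
    then consider "w \<in> extent A B" | "w \<in> snd ` S u" by blast
    then show "w \<in> extent A (insert u B)"
    proof cases
      case 1
      then show ?thesis using extent_mono[of B "insert u B" A] A B u by (auto simp: U_def)
    next
      case 2
      then obtain v v' where v: "v \<in> B" "v' \<in> B" "w \<in> U" "c {v, w} = c {v', u}"
        by (auto simp: S_def P_def col_def reach_cols_def)
      \<comment> \<open>The edge from \<open>v'\<close> to \<open>u\<close> supplies this color,
        which makes \<open>w\<close> derivable through \<open>v\<close>.\<close>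
      have "c {v, w} \<in> colors (insert u B)"
        unfolding v(4) using v uB by (intro color_in_colors) auto
      then have "v \<in> old (insert u B) w" using v by (simp add: old_def)
      then show ?thesis
        using v BU BN by (auto simp: extent_def derived_def U_def)
    qed
  qed
  have finext: "finite (extent A (insert u B))"
    using fin by (simp add: extent_def)
  have "card (extent A B) + card (snd ` S u) = card (extent A B \<union> snd ` S u)"
    using fin finP by (intro card_Un_disjoint[symmetric])
      (auto simp: extent_def S_def P_def U_def)
  also have "\<dots> \<le> card (extent A (insert u B))"
    using sub finext by (rule card_mono[rotated])
  finally have fin1: "real (card (extent A B)) + card (snd ` S u) \<le> card (extent A (insert u B))"
    by (metis of_nat_add of_nat_le_iff)
  \<comment> \<open>The extent is at most \<open>2 * m\<close>, and \<open>U\<close> is at least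
    half of \<open>A\<close>; this is the 4 in the growth rate.\<close>
  have "card (extent A B) * card A \<le> (2 * m) * (2 * card U)"
    using ext cardU by (intro mult_le_mono) (auto simp: m_def)
  also have "\<dots> \<le> 4 * \<Delta> * k * card (snd ` S u)"
    using gain by (simp add: mult_ac)
  finally have "real (card (extent A B)) * card A \<le> 4 * \<Delta> * k * card (snd ` S u)"
    by (metis of_nat_le_iff of_nat_mult of_nat_numeral)
  then have "card (extent A B) * card A / (4 * \<Delta> * k) \<le> card (snd ` S u)"
    using k Delta_pos by (simp add: field_simps)
  with fin1 have "(1 + card A / (4 * \<Delta> * k)) * card (extent A B) \<le> card (extent A (insert u B))"
    by (simp add: algebra_simps)
  then show ?thesis using that u by (auto simp: U_def)
qed

text \<open>Add a derivable vertex of \<open>A\<close> whenever the extent is large enough to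
  guarantee one, and otherwise a seed from \<open>extent_growth\<close>. Derivations do not shrink
  the extent, so the power of the growth factor counts the seeds.\<close>

lemma growing_phase:
  assumes A: "A \<subseteq> {..<N}" and k: "card (colors A) \<le> k" "0 < k"
    and m: "1 \<le> m" "4 * m \<le> card A"
  shows "\<exists>B s d. B \<subseteq> A \<and> reach (Suc s) d B \<and> card B = m \<and>
    (1 + card A / (4 * \<Delta> * k)) ^ s \<le> card A"
proof -
  have "\<exists>B s d. B \<subseteq> A \<and> reach (Suc s) d B \<and> card B = m \<and>
    (1 + card A / (4 * \<Delta> * k)) ^ s \<le> card (extent A B)"
    using m
  proof (induction m rule: nat_induct_at_least)
    case base
    then obtain a where a: "a \<in> A" by fastforce
    \<comment> \<open>The first seed yields no growth, hence \<open>Suc s\<close> seeds against the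
      exponent \<open>s\<close>.\<close>
    have "reach (Suc 0) 0 {a}"
      using reach.seed[OF reach.empty, of a] a A by auto
    moreover have "1 \<le> card (extent A {a})"
      using a A finite_subset[OF A] by (simp add: extent_def Suc_le_eq card_gt_0_iff)
    ultimately show ?case
      using a by (intro exI[of _ "{a}"] exI[of _ 0]) auto
  next
    case (Suc m)
    then obtain B s d where B: "B \<subseteq> A" "reach (Suc s) d B" "card B = m"
      and pow: "(1 + card A / (4 * \<Delta> * k)) ^ s \<le> card (extent A B)" by auto
    have fin: "finite A" "finite B" using finite_subset[OF A] finite_subset[OF B(1)] by auto
    show ?case
    proof (cases "card (extent A B) \<le> 2 * card B \<and> 2 * card (extent A B) \<le> card A")
      case True
      have "B \<noteq> {}" using B(3) Suc.hyps by auto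
      then obtain u where u: "u \<in> A - extent A B"
        and g: "(1 + card A / (4 * \<Delta> * k)) * card (extent A B) \<le> card (extent A (insert u B))"
        using extent_growth[OF A B(1) _ k] True by blast
      have uB: "u \<notin> B" "u < N" using u A by (auto simp: extent_def)
      have "(1 + card A / (4 * \<Delta> * k)) ^ Suc s \<le> (1 + card A / (4 * \<Delta> * k)) * card (extent A B)"
        using pow by (simp add: mult_left_mono)
      then have "(1 + card A / (4 * \<Delta> * k)) ^ Suc s \<le> card (extent A (insert u B))"
        using g by linarith
      moreover have "reach (Suc (Suc s)) d (insert u B)"
        using B uB by (intro reach.seed)
      ultimately show ?thesis
        using B uB fin u by (intro exI[of _ "insert u B"] exI[of _ "Suc s"] exI[of _ d]) auto
    next
      case False
      \<comment> \<open>If the extent is only known to exceed half of \<open>A\<close>, it still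
        exceeds \<open>B\<close>, because \<open>4 * Suc m <= card A\<close>.\<close>
      have "card B < card (extent A B)"
        using False B(3) Suc.prems by auto
      then have "\<not> extent A B \<subseteq> B" using fin card_mono leD by blast
      then obtain w where w: "w \<in> A" "w \<in> derived B" by (auto simp: extent_def)
      have wB: "w \<notin> B" using w by (auto simp: derived_def)
      have "extent A B \<subseteq> extent A (insert w B)"
        using A B w by (intro extent_mono) auto
      then have "card (extent A B) \<le> card (extent A (insert w B))"
        using fin by (intro card_mono) (auto simp: extent_def)
      then have "(1 + card A / (4 * \<Delta> * k)) ^ s \<le> card (extent A (insert w B))"
        using pow by linarith
      moreover have "reach (Suc s) (Suc d) (insert w B)"
        using B w by (intro reach.deriv)
      ultimately show ?thesis
        using B wB fin w by (intro exI[of _ "insert w B"] exI[of _ s] exI[of _ "Suc d"]) auto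
    qed
  qed
  then obtain B s d where B: "B \<subseteq> A" "reach (Suc s) d B" "card B = m"
      and pow: "(1 + card A / (4 * \<Delta> * k)) ^ s \<le> card (extent A B)" by auto
  have "card (extent A B) \<le> card A"
    using A B finite_subset[OF A] by (intro card_mono) (auto simp: extent_def)
  then have "(1 + card A / (4 * \<Delta> * k)) ^ s \<le> card A"
    using pow by linarith
  then show ?thesis using B by blast
qed

text \<open>Keep adding vertices of \<open>A\<close> outside \<open>half_old B\<close>. More than
  half of the edges from such a vertex to \<open>B\<close> have new colors, so it brings at least
  \<open>M / (2 * \<Delta>)\<close> of them; the process stops because \<open>A - B\<close>
  shrinks.\<close>

lemma saturating_phase:
  assumes A: "A \<subseteq> {..<N}" and "B \<subseteq> A" "reach s d B" "M \<le> card B"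
  shows "\<exists>B' e. B \<subseteq> B' \<and> B' \<subseteq> A \<and> reach (s + e) d B' \<and> A \<subseteq> B' \<union> half_old B' \<and>
    e * M + 2 * \<Delta> * card (colors B) \<le> 2 * \<Delta> * card (colors B')"
  using assms(2-)
proof (induction "card (A - B)" arbitrary: B s rule: less_induct)
  case less
  have fin: "finite A" "finite B" using finite_subset[OF A] finite_subset[OF less.prems(1)] by auto
  show ?case
  proof (cases "A \<subseteq> B \<union> half_old B")
    case True
    then show ?thesis using less.prems by (intro exI[of _ B] exI[of _ 0]) auto
  next
    case False
    then obtain w where w: "w \<in> A" "w \<notin> B" "w \<notin> half_old B" by blast
    have wN: "w < N" using w A by auto
    have "2 * card (old B w) < card B" using w wN by (auto simp: half_old_def)
    moreover have "card (B - old B w) = card B - card (old B w)"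
      using fin by (intro card_Diff_subset) (auto simp: old_def)
    ultimately have "M \<le> 2 * card (B - old B w)" using less.prems by linarith
    moreover have "card (B - old B w) + \<Delta> * card (colors B) \<le> \<Delta> * card (colors (insert w B))"
      using less.prems A w wN by (intro card_new_colors) auto
    ultimately have gain: "M + 2 * \<Delta> * card (colors B) \<le> 2 * \<Delta> * card (colors (insert w B))"
      by linarith
    have "card (A - insert w B) < card (A - B)"
      using w fin by (intro psubset_card_mono) auto
    moreover have "reach (Suc s) d (insert w B)"
      using less.prems w wN by (intro reach.seed)
    ultimately obtain B' e where B': "insert w B \<subseteq> B'" "B' \<subseteq> A" "reach (Suc s + e) d B'"
      "A \<subseteq> B' \<union> half_old B'"
      "e * M + 2 * \<Delta> * card (colors (insert w B)) \<le> 2 * \<Delta> * card (colors B')"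
      using less.hyps[of "insert w B" "Suc s"] less.prems w fin by (auto simp: le_SucI)
    then show ?thesis
      using gain by (intro exI[of _ B'] exI[of _ "Suc e"]) auto
  qed
qed

lemma fingerprint:
  assumes A: "A \<subseteq> {..<N}" and k: "card (colors A) \<le> k" "0 < k"
    and M: "1 \<le> M" "4 * M \<le> card A"
  obtains B s e d where "B \<subseteq> A" "B \<noteq> {}" "reach (Suc s + e) d B" "A \<subseteq> B \<union> half_old B" "d \<le> M"
    and "(1 + card A / (4 * \<Delta> * k)) ^ s \<le> card A" and "e * M \<le> 2 * \<Delta> * card (colors B)"
proof -
  obtain B0 s d where B0: "B0 \<subseteq> A" "reach (Suc s) d B0" "card B0 = M"
    and pow: "(1 + card A / (4 * \<Delta> * k)) ^ s \<le> card A"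
    using growing_phase[OF assms] by blast
  obtain B e where B: "B0 \<subseteq> B" "B \<subseteq> A" "reach (Suc s + e) d B" "A \<subseteq> B \<union> half_old B"
    "e * M + 2 * \<Delta> * card (colors B0) \<le> 2 * \<Delta> * card (colors B)"
    using saturating_phase[OF A B0(1,2), of M] B0(3) by auto
  \<comment> \<open>The saturating phase adds only seeds, so \<open>d\<close> is still the count
    from the growing phase.\<close>
  have "d \<le> M" using reach_subset_card[OF B0(2)] B0(3) by simp
  moreover have "B \<noteq> {}" using B0(3) M(1) B(1) by auto
  ultimately show ?thesis using that B pow by simp
qed

text \<open>The logarithm of the bound on the number of sets \<open>B\<close> with \<open>reach s d B\<close>.\<close>

definition cost :: "nat \<Rightarrow> nat \<Rightarrow> nat \<Rightarrow> real" where
  "cost n s d = s * ln (2 * real N) + d * ln (2 * real \<Delta> * real n ^ 3)"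

section \<open>Balancing the cost of a fingerprint\<close>

text \<open>Three costs are balanced: the seeds of the growing phase and the derivations are charged
  to \<open>k\<close>, the seeds of the saturating phase to the colors of \<open>B\<close> that they
  create.\<close>

lemma cheap_fingerprint:
  fixes \<epsilon> :: real
  assumes A: "A \<subseteq> {..<N}" "card A = n"
    and eps: "0 < \<epsilon>" "\<epsilon> \<le> 1"
    and n: "2 * \<Delta> \<le> n" "1 \<le> ln (real n)" "1 \<le> \<epsilon> * n / (8 * ln n)"
    and N: "ln (real n) * ln (2 * real N) \<le> \<epsilon>\<^sup>2 / (64 * \<Delta>) * n"
  obtains B s d where "B \<subseteq> A" "B \<noteq> {}" "reach s d B" "A \<subseteq> B \<union> half_old B"
    and "cost n s d \<le> \<epsilon> * (max n (card (colors A)) + card (colors B))"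
proof -
  define k where "k = max n (card (colors A))"
  \<comment> \<open>A larger \<open>M\<close> means fewer late seeds. This value still keeps the
    derivations, at most \<open>M\<close> of them at a price of \<open>4 * ln n\<close> each, within
    \<open>\<epsilon> * n / 2\<close>.\<close>
  define M where "M = nat \<lfloor>\<epsilon> * n / (8 * ln n)\<rfloor>"
  define l where "l = ln (real n)"
  define L where "L = ln (2 * real N)"
  have l: "1 \<le> l" using n by (simp add: l_def)
  have npos: "0 < n" using n Delta_pos by linarith
  then have "0 < N" using A by (metis card.empty lessThan_0 less_not_refl neq0_conv subset_empty)
  then have L: "0 \<le> L" by (simp add: L_def)
  have kn: "n \<le> k" "card (colors A) \<le> k" "0 < k" using npos by (auto simp: k_def)
  have Delta: "1 \<le> real \<Delta>" using Delta_pos by simp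
  have lL: "l * L \<le> \<epsilon>\<^sup>2 / (64 * \<Delta>) * n" using N by (simp add: l_def L_def)
  have "1 \<le> \<lfloor>\<epsilon> * n / (8 * l)\<rfloor>" using n(3) by (simp add: l_def)
  then have "real M = of_int \<lfloor>\<epsilon> * n / (8 * l)\<rfloor>" and M1: "1 \<le> M"
    unfolding M_def l_def by linarith+
  \<comment> \<open>Rounding down a number that is at least 1 loses at most a factor 2.\<close>
  then have M_le: "M \<le> \<epsilon> * n / (8 * l)" and "\<epsilon> * n / (8 * l) \<le> 2 * real M"
    by linarith+
  then have M_ge: "\<epsilon> * n / (16 * l) \<le> M"
    by (simp add: field_simps)
  have "\<epsilon> * n / (8 * l) \<le> n / 8"
  proof -
    have "\<epsilon> * n \<le> l * n" using eps l by (intro mult_right_mono) auto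
    then show ?thesis using l by (simp add: field_simps)
  qed
  then have M4: "4 * M \<le> card A" using M_le A(2) by linarith
  obtain B s e d where B: "B \<subseteq> A" "B \<noteq> {}" "reach (Suc s + e) d B" "A \<subseteq> B \<union> half_old B" "d \<le> M"
    and pow: "(1 + n / (4 * \<Delta> * k)) ^ s \<le> n" and eM: "e * M \<le> 2 * \<Delta> * card (colors B)"
    by (rule fingerprint[OF A(1) kn(2,3) M1 M4, unfolded A(2)])
  define T where "T = card (colors B)"
  define \<theta> where "\<theta> = real n / (4 * \<Delta> * k)"
  have \<theta>: "0 \<le> \<theta>" "\<theta> \<le> 1/2"
  proof -
    have "real n \<le> \<Delta> * real k"
      using kn Delta mult_mono[of 1 "real \<Delta>" "real n" "real k"] by simp
    then show "\<theta> \<le> 1/2" using kn Delta by (simp add: \<theta>_def field_simps)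
  qed (simp add: \<theta>_def)
  have "s * \<theta> \<le> 2 * l"
    unfolding l_def using \<theta> pow by (intro power_le_imp_mult_le_ln) (simp_all add: \<theta>_def)
  then have sn: "s * real n \<le> 8 * \<Delta> * k * l"
    using kn Delta by (simp add: \<theta>_def field_simps)
  have "s * L * n \<le> 8 * \<Delta> * k * (l * L)"
    using mult_right_mono[OF sn L] by (simp add: mult_ac)
  also have "\<dots> \<le> 8 * \<Delta> * k * (\<epsilon>\<^sup>2 / (64 * \<Delta>) * n)"
    using lL by (intro mult_left_mono) auto
  also have "\<dots> = (\<epsilon>\<^sup>2 / 8 * k) * n"
    using Delta by (simp add: field_simps)
  finally have sL: "s * L \<le> \<epsilon>\<^sup>2 / 8 * k"
    using npos by simp
  have "L \<le> l * L" using mult_right_mono[OF l L] by simp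
  also have "\<dots> \<le> \<epsilon>\<^sup>2 / (64 * \<Delta>) * n" by (rule lL)
  also have "\<dots> \<le> \<epsilon>\<^sup>2 / 64 * k"
    using Delta kn by (intro mult_mono divide_left_mono) auto
  finally have L1: "L \<le> \<epsilon>\<^sup>2 / 64 * k" .
  have e2: "\<epsilon>\<^sup>2 \<le> \<epsilon>" using eps by (simp add: power2_eq_square mult_left_le)
  have "\<epsilon>\<^sup>2 * k \<le> \<epsilon> * k" using e2 by (intro mult_right_mono) auto
  moreover have "0 \<le> \<epsilon> * k" using eps by simp
  moreover have "Suc s * L = s * L + L" by (simp add: algebra_simps)
  ultimately have seeds: "Suc s * L \<le> \<epsilon> / 2 * k"
    using sL L1 by linarith
  \<comment> \<open>The late seeds fix the constant 64 in the hypothesis on \<open>N\<close>: it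
    gives exactly the share \<open>\<epsilon> / 2 * T\<close>.\<close>
  have "e * (\<epsilon> * n / (16 * l)) \<le> e * real M"
    using M_ge by (intro mult_left_mono) auto
  also have "\<dots> \<le> 2 * \<Delta> * T"
    using eM unfolding T_def by (metis of_nat_le_iff of_nat_mult of_nat_numeral)
  finally have "e * \<epsilon> * n \<le> 32 * \<Delta> * T * l"
    using l by (simp add: field_simps)
  then have "e * \<epsilon> * n * L \<le> 32 * \<Delta> * T * l * L"
    using L by (rule mult_right_mono)
  also have "\<dots> = 32 * \<Delta> * T * (l * L)" by simp
  also have "\<dots> \<le> 32 * \<Delta> * T * (\<epsilon>\<^sup>2 / (64 * \<Delta>) * n)"
    using lL by (intro mult_left_mono) auto
  also have "\<dots> = (\<epsilon> / 2 * T) * (\<epsilon> * n)"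
    using Delta by (simp add: field_simps power2_eq_square)
  finally have "(e * L) * (\<epsilon> * n) \<le> (\<epsilon> / 2 * T) * (\<epsilon> * n)"
    by (simp add: mult_ac)
  then have late: "e * L \<le> \<epsilon> / 2 * T"
    by (rule mult_right_le_imp_le) (use eps npos in simp)
  have ln4: "ln (2 * real \<Delta> * real n ^ 3) \<le> 4 * l"
  proof -
    have "2 * real \<Delta> \<le> n" using n(1) by linarith
    then have "2 * real \<Delta> * real n ^ 3 \<le> real n * real n ^ 3"
      by (intro mult_right_mono) auto
    also have "\<dots> = real n ^ 4" by (simp add: eval_nat_numeral)
    finally have "ln (2 * real \<Delta> * real n ^ 3) \<le> ln (real n ^ 4)"
      using npos Delta by (subst ln_le_cancel_iff) auto
    then show ?thesis using npos by (simp add: ln_realpow l_def)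
  qed
  have "d * ln (2 * real \<Delta> * real n ^ 3) \<le> M * (4 * l)"
    using ln4 B(5) l by (meson mult_left_mono mult_right_mono of_nat_0_le_iff of_nat_le_iff order_trans
        mult_nonneg_nonneg zero_le_numeral zero_le_one)
  also have "\<dots> \<le> \<epsilon> * n / (8 * l) * (4 * l)"
    using M_le l by (intro mult_right_mono) auto
  also have "\<dots> = \<epsilon> / 2 * n" using l by simp
  also have "\<dots> \<le> \<epsilon> / 2 * k" using eps kn by (intro mult_left_mono) auto
  finally have der: "d * ln (2 * real \<Delta> * real n ^ 3) \<le> \<epsilon> / 2 * k" .
  have "cost n (Suc s + e) d = Suc s * L + e * L + d * ln (2 * real \<Delta> * real n ^ 3)"
    by (simp add: cost_def L_def algebra_simps)
  also have "\<dots> \<le> \<epsilon> * k + \<epsilon> / 2 * T" using seeds late der by linarith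
  also have "\<dots> \<le> \<epsilon> * (k + T)" using eps by (simp add: algebra_simps)
  finally show ?thesis using that B by (simp add: k_def T_def)
qed

section \<open>Small families of containers\<close>

text \<open>Only the total cost is limited, not the two counts separately. There are at most
  \<open>(n + 1)^2\<close> index pairs, so the union loses only a polynomial factor against
  \<open>exp x\<close>.\<close>

definition cheap :: "real \<Rightarrow> nat \<Rightarrow> nat set set" where
  "cheap x n = (\<Union>(s, d)\<in>{(s, d). s + d \<le> n \<and> cost n s d \<le> x}. {B. reach s d B})"

lemma finite_card_cheap:
  assumes "0 < N" "0 < n"
  shows "finite (cheap x n)" and "card (cheap x n) \<le> (real n + 1)\<^sup>2 * exp x"
proof -
  let ?I = "{(s, d). s + d \<le> n \<and> cost n s d \<le> x}"
  have I: "?I \<subseteq> {..n} \<times> {..n}" by auto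
  then have finI: "finite ?I" by (rule finite_subset) auto
  then show "finite (cheap x n)"
    by (auto simp: cheap_def finite_reach)
  have each: "card {B. reach s d B} \<le> exp x" if "s + d \<le> n" "cost n s d \<le> x" for s d
  proof -
    have "real (card {B. reach s d B}) \<le> real ((2 * N) ^ s * (2 * \<Delta> * n ^ 3) ^ d)"
      using card_reach_le[OF that(1)] by (simp only: of_nat_le_iff)
    also have "\<dots> = (2 * real N) ^ s * (2 * real \<Delta> * real n ^ 3) ^ d" by simp
    also have "\<dots> = exp (cost n s d)"
      using assms Delta_pos by (simp add: cost_def exp_add exp_of_nat_mult)
    also have "\<dots> \<le> exp x" using that by simp
    finally show ?thesis .
  qed
  have "card (cheap x n) \<le> (\<Sum>i\<in>?I. card (case i of (s, d) \<Rightarrow> {B. reach s d B}))"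
    unfolding cheap_def by (rule card_UN_le[OF finI])
  then have "real (card (cheap x n)) \<le> real (\<Sum>i\<in>?I. card (case i of (s, d) \<Rightarrow> {B. reach s d B}))"
    by (simp only: of_nat_le_iff)
  also have "\<dots> = (\<Sum>i\<in>?I. real (card (case i of (s, d) \<Rightarrow> {B. reach s d B})))"
    by (rule of_nat_sum)
  also have "\<dots> \<le> (\<Sum>i\<in>?I. exp x)"
    by (intro sum_mono) (use each in auto)
  also have "\<dots> = card ?I * exp x" by simp
  also have "\<dots> \<le> (real n + 1)\<^sup>2 * exp x"
  proof (rule mult_right_mono)
    have "card ?I \<le> card ({..n} \<times> {..n})" using I by (intro card_mono) auto
    also have "\<dots> = (n + 1)\<^sup>2" by (simp add: card_cartesian_product power2_eq_square)
    finally have "real (card ?I) \<le> real ((n + 1)\<^sup>2)" by (simp only: of_nat_le_iff)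
    then show "real (card ?I) \<le> (real n + 1)\<^sup>2" by (simp add: add.commute)
  qed simp
  finally show "card (cheap x n) \<le> (real n + 1)\<^sup>2 * exp x" .
qed

text \<open>The weight \<open>x = n / t\<close> bounds the count by
  \<open>exp (n * (ln (t / n) + 2 * \<Delta>))\<close>. As \<open>t / n >= K\<close>, the hypothesis
  on \<open>K\<close> turns the exponent into \<open>\<eta> * t\<close>.\<close>

lemma card_completions_le:
  fixes \<eta> K :: real
  assumes "0 < n" and K: "1 \<le> K" "\<And>x. K \<le> x \<Longrightarrow> ln x + 2 * \<Delta> \<le> \<eta> * x"
    and t: "K * n \<le> t" and W: "finite W" "card W \<le> 2 * \<Delta> * t"
  shows "card {F. F \<subseteq> W \<and> card F \<le> n} \<le> exp (\<eta> * t)"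
proof -
  have "1 * real n \<le> K * n" using K by (intro mult_right_mono) auto
  then have nt: "real n \<le> t" using t by linarith
  define x where "x = real n / t"
  have x: "0 < x" "x \<le> 1" using assms(1) nt by (auto simp: x_def)
  let ?C = "{F. F \<subseteq> W \<and> card F \<le> n}"
  have "card ?C * x ^ n \<le> exp (x * card W)"
    by (rule card_bounded_subsets_le[OF W(1) x])
  also have "\<dots> \<le> exp (2 * \<Delta> * n)"
  proof -
    have "real (card W) \<le> real (2 * \<Delta> * t)" using W(2) by (simp only: of_nat_le_iff)
    then have "x * card W \<le> x * (2 * \<Delta> * t)"
      using x by (intro mult_left_mono) auto
    also have "\<dots> = 2 * \<Delta> * n" using nt assms(1) by (simp add: x_def)
    finally show ?thesis by simp
  qed
  finally have "card ?C \<le> exp (2 * \<Delta> * n) * (t / n) ^ n"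
    using assms(1) nt by (simp add: x_def field_simps power_divide)
  also have "(t / n) ^ n = exp (n * ln (t / n))"
    using assms(1) nt by (simp add: exp_of_nat_mult)
  also have "exp (2 * \<Delta> * n) * exp (n * ln (t / n)) = exp (n * (ln (t / n) + 2 * \<Delta>))"
    by (simp add: exp_add[symmetric] algebra_simps)
  also have "\<dots> \<le> exp (n * (\<eta> * (t / n)))"
    using K(2)[of "t / n"] t assms(1) by (simp add: field_simps)
  also have "\<dots> = exp (\<eta> * t)" using assms(1) by simp
  finally show ?thesis .
qed

text \<open>Containers are sorted by the number \<open>t\<close> of colors they span, since this
  determines the probability \<open>p ^ t\<close> that all these colors are selected.\<close>

lemma containers_exist:
  fixes \<eta> \<epsilon> K :: real
  assumes eps: "0 < \<epsilon>" "\<epsilon> \<le> 1" "\<epsilon> * (4 * \<Delta> * K + 1) \<le> \<eta>"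
    and K: "1 \<le> K" "\<And>x. K \<le> x \<Longrightarrow> ln x + 2 * \<Delta> \<le> \<eta> * x"
    and n: "2 * \<Delta> \<le> n" "1 \<le> ln (real n)" "1 \<le> \<epsilon> * n / (8 * ln n)"
      "2 * (real n + 1)\<^sup>2 \<le> exp (\<eta> * n / (4 * \<Delta>))"
    and N: "ln (real n) * ln (2 * real N) \<le> \<epsilon>\<^sup>2 / (64 * \<Delta>) * n" "0 < N"
  obtains X :: "nat \<Rightarrow> nat set set" where "\<And>t. finite (X t)" "\<And>t. card (X t) \<le> exp (3 * \<eta> * t)"
    and "\<And>t B. B \<in> X t \<Longrightarrow> B \<subseteq> {..<N} \<and> card (colors B) = t"
    and "\<And>A. \<lbrakk>A \<subseteq> {..<N}; card A = n\<rbrakk> \<Longrightarrow> \<exists>t. n \<le> 4 * \<Delta> * t \<and> (\<exists>B\<in>X t. B \<subseteq> A)"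
proof
  \<comment> \<open>For \<open>A\<close> with at most \<open>K * n\<close> colors: \<open>n\<close>
    is linear in the number of colors of the fingerprint \<open>B\<close>, so \<open>B\<close> pays
    for its own cost.\<close>
  define X1 where "X1 t = {B \<in> cheap (\<eta> * t) n. card (colors B) = t}" for t
  define H where "H t = {B \<in> cheap (\<eta> * t) n. B \<subseteq> {..<N} \<and> B \<noteq> {} \<and> card (colors B) \<le> t}" for t
  define compl where "compl B = {F. F \<subseteq> half_old B \<and> card F \<le> n}" for B
  \<comment> \<open>For \<open>A\<close> with more than \<open>K * n\<close> colors \<open>B\<close>
    may span too few colors to pay, so \<open>A\<close> itself is the container, specified as
    \<open>B\<close> together with a subset of \<open>half_old B\<close>.\<close>
  define X2 where "X2 t = (if K * n \<le> t then {A \<in> (\<Union>B\<in>H t. (\<union>) B ` compl B).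
    A \<subseteq> {..<N} \<and> card (colors A) = t} else {})" for t
  \<comment> \<open>The restriction on \<open>t\<close> lets one factor
    \<open>exp (\<eta> * t)\<close> absorb the polynomial. With one factor for \<open>B\<close> and
    one for its completion this makes \<open>3 * \<eta>\<close>.\<close>
  define X where "X t = (if n \<le> 4 * \<Delta> * t then X1 t \<union> X2 t else {})" for t
  have Delta: "1 \<le> real \<Delta>" using Delta_pos by simp
  have npos: "0 < n" "2 \<le> n" using n Delta_pos by linarith+
  have eta: "2 * \<epsilon> \<le> \<eta>" "0 < \<eta>"
  proof -
    have "1 \<le> 4 * \<Delta> * K" using mult_mono[OF Delta K(1)] Delta by simp
    then have "\<epsilon> * 2 \<le> \<epsilon> * (4 * \<Delta> * K + 1)" using eps(1) by (intro mult_left_mono) auto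
    then show "2 * \<epsilon> \<le> \<eta>" using eps by linarith
    then show "0 < \<eta>" using eps by linarith
  qed
  have finhalf: "finite (half_old B)" for B by (simp add: half_old_def)
  have fincompl: "finite (compl B)" for B
    by (rule finite_subset[of _ "Pow (half_old B)"]) (auto simp: compl_def finhalf)
  have finX1: "finite (X1 t)" and cardX1: "card (X1 t) \<le> (real n + 1)\<^sup>2 * exp (\<eta> * t)" for t
  proof -
    show "finite (X1 t)" using finite_card_cheap(1)[OF N(2) npos(1)] by (simp add: X1_def)
    have "card (X1 t) \<le> card (cheap (\<eta> * t) n)"
      using finite_card_cheap(1)[OF N(2) npos(1)] by (intro card_mono) (auto simp: X1_def)
    then show "card (X1 t) \<le> (real n + 1)\<^sup>2 * exp (\<eta> * t)"
      using finite_card_cheap(2)[OF N(2) npos(1), of "\<eta> * t"] by linarith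
  qed
  have finH: "finite (H t)" and cardH: "card (H t) \<le> (real n + 1)\<^sup>2 * exp (\<eta> * t)" for t
  proof -
    show "finite (H t)" using finite_card_cheap(1)[OF N(2) npos(1)] by (simp add: H_def)
    have "card (H t) \<le> card (cheap (\<eta> * t) n)"
      using finite_card_cheap(1)[OF N(2) npos(1)] by (intro card_mono) (auto simp: H_def)
    then show "card (H t) \<le> (real n + 1)\<^sup>2 * exp (\<eta> * t)"
      using finite_card_cheap(2)[OF N(2) npos(1), of "\<eta> * t"] by linarith
  qed
  have finU: "finite (\<Union>B\<in>H t. (\<union>) B ` compl B)" for t
    using finH fincompl by auto
  then have finX2: "finite (X2 t)" for t
    by (simp add: X2_def)
  have cardX2: "card (X2 t) \<le> (real n + 1)\<^sup>2 * exp (2 * \<eta> * t)" for t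
  proof (cases "K * n \<le> t")
    case True
    have "card (X2 t) \<le> card (\<Union>B\<in>H t. (\<union>) B ` compl B)"
      using finU by (intro card_mono) (auto simp: X2_def)
    also have "\<dots> \<le> (\<Sum>B\<in>H t. card ((\<union>) B ` compl B))"
      by (rule card_UN_le[OF finH])
    finally have "real (card (X2 t)) \<le> real (\<Sum>B\<in>H t. card ((\<union>) B ` compl B))"
      by (simp only: of_nat_le_iff)
    also have "\<dots> = (\<Sum>B\<in>H t. real (card ((\<union>) B ` compl B)))"
      by (rule of_nat_sum)
    also have "\<dots> \<le> (\<Sum>B\<in>H t. exp (\<eta> * t))"
    proof (rule sum_mono)
      fix B assume "B \<in> H t"
      then have B: "B \<subseteq> {..<N}" "B \<noteq> {}" "card (colors B) \<le> t" by (auto simp: H_def)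
      have "card (half_old B) \<le> 2 * \<Delta> * t"
        using card_half_old_le[OF B(1,2)] B(3) by (meson mult_le_mono2 order_trans)
      then have "card (compl B) \<le> exp (\<eta> * t)"
        unfolding compl_def using finhalf True by (intro card_completions_le[OF npos(1) K])
      then show "real (card ((\<union>) B ` compl B)) \<le> exp (\<eta> * t)"
        using card_image_le[OF fincompl, of "(\<union>) B" B] by linarith
    qed
    also have "\<dots> = card (H t) * exp (\<eta> * t)" by simp
    also have "\<dots> \<le> ((real n + 1)\<^sup>2 * exp (\<eta> * t)) * exp (\<eta> * t)"
      by (intro mult_right_mono cardH) simp
    also have "\<dots> = (real n + 1)\<^sup>2 * exp (2 * \<eta> * t)"
      by (simp add: exp_add[symmetric] mult.assoc)
    finally show ?thesis .
  qed (simp add: X2_def)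
  show "finite (X t)" for t using finX1 finX2 by (simp add: X_def)
  show "card (X t) \<le> exp (3 * \<eta> * t)" for t
  proof (cases "n \<le> 4 * \<Delta> * t")
    case True
    have "real n \<le> 4 * \<Delta> * real t" using True by (metis of_nat_le_iff of_nat_mult of_nat_numeral)
    then have "\<eta> * n \<le> \<eta> * (4 * \<Delta> * real t)" using eta by (intro mult_left_mono) auto
    then have "\<eta> * n / (4 * \<Delta>) \<le> \<eta> * t" using Delta by (simp add: field_simps)
    then have small: "2 * (real n + 1)\<^sup>2 \<le> exp (\<eta> * t)"
      using n(4) by (meson exp_le_cancel_iff order_trans)
    have "real (card (X t)) \<le> real (card (X1 t)) + card (X2 t)"
      using True card_Un_le[of "X1 t" "X2 t"] by (simp add: X_def)
    also have "\<dots> \<le> (real n + 1)\<^sup>2 * exp (\<eta> * t) + (real n + 1)\<^sup>2 * exp (2 * \<eta> * t)"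
      by (intro add_mono cardX1 cardX2)
    also have "\<dots> \<le> (real n + 1)\<^sup>2 * exp (2 * \<eta> * t) + (real n + 1)\<^sup>2 * exp (2 * \<eta> * t)"
      using eta by (intro add_mono mult_left_mono) auto
    also have "\<dots> = 2 * (real n + 1)\<^sup>2 * exp (2 * \<eta> * t)" by simp
    also have "\<dots> \<le> exp (\<eta> * t) * exp (2 * \<eta> * t)"
      using small by (intro mult_right_mono) auto
    also have "\<dots> = exp (3 * \<eta> * t)" by (simp add: exp_add[symmetric])
    finally show ?thesis .
  qed (simp add: X_def)
  show "B \<subseteq> {..<N} \<and> card (colors B) = t" if "B \<in> X t" for t B
    using that reach_subset_card by (auto simp: X_def X1_def X2_def cheap_def split: if_splits)
  show "\<exists>t. n \<le> 4 * \<Delta> * t \<and> (\<exists>B\<in>X t. B \<subseteq> A)" if A: "A \<subseteq> {..<N}" "card A = n" for A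
  proof -
    have finA: "finite A" using A(1) finite_subset by blast
    obtain B s d where B: "B \<subseteq> A" "B \<noteq> {}" "reach s d B" "A \<subseteq> B \<union> half_old B"
      and cost: "cost n s d \<le> \<epsilon> * (max n (card (colors A)) + card (colors B))"
      using cheap_fingerprint[OF A eps(1,2) n(1-3) N(1)] by blast
    define T where "T = card (colors B)"
    have BN: "B \<subseteq> {..<N}" using B A by blast
    have finB: "finite B" using B(1) finA finite_subset by blast
    have cB: "card B \<le> n" using B(1) finA A(2) card_mono by blast
    have sd: "s + d \<le> n" using reach_subset_card[OF B(3)] cB by simp
    \<comment> \<open>Both parts of this cover of \<open>A\<close> are linear in \<open>T\<close>.
      As \<open>n >= 2\<close> excludes \<open>\<Delta> * T = 0\<close>, the additive 1 is absorbed
      by raising 3 to 4.\<close>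
    have "n \<le> card (B \<union> half_old B)"
      using A(2) B(4) finB finhalf by (metis card_mono finite_UnI)
    also have "\<dots> \<le> card B + card (half_old B)" by (rule card_Un_le)
    also have "\<dots> \<le> (\<Delta> * T + 1) + 2 * \<Delta> * T"
      unfolding T_def by (intro add_mono card_le_card_colors card_half_old_le BN B(2))
    finally have "n \<le> 3 * (\<Delta> * T) + 1" by (simp add: mult.commute)
    moreover from this have "1 \<le> \<Delta> * T" using npos by linarith
    ultimately have nT: "n \<le> 4 * (\<Delta> * T)" by linarith
    have "real n \<le> real (4 * (\<Delta> * T))" using nT by (simp only: of_nat_le_iff)
    then have nT': "real n \<le> 4 * \<Delta> * T" by simp
    show ?thesis
    proof (cases "card (colors A) \<le> K * n")
      case True
      have "1 * real n \<le> K * n" using K by (intro mult_right_mono) auto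
      then have "real (max n (card (colors A))) \<le> K * n" using True by auto
      also have "\<dots> \<le> K * (4 * \<Delta> * T)"
        using nT' K by (intro mult_left_mono) auto
      finally have "real (max n (card (colors A)) + T) \<le> (4 * \<Delta> * K + 1) * T"
        by (simp add: algebra_simps)
      then have "cost n s d \<le> \<epsilon> * ((4 * \<Delta> * K + 1) * T)"
        using cost eps(1) unfolding T_def by (meson mult_left_mono order_trans less_imp_le)
      also have "\<dots> \<le> \<eta> * T"
        using mult_right_mono[OF eps(3), of T] by (simp add: mult.assoc)
      finally have "B \<in> X1 T"
        using sd B(3) by (auto simp: X1_def cheap_def T_def)
      then show ?thesis using nT B(1) by (intro exI[of _ T]) (auto simp: X_def)
    next
      case False
      define t where "t = card (colors A)"
      have "1 * real n \<le> K * n" using K by (intro mult_right_mono) auto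
      then have nt: "n \<le> t" using False by (simp add: t_def)
      have Tt: "T \<le> t"
        unfolding T_def t_def using B(1) finA by (intro card_mono finite_colors colors_mono)
      have "cost n s d \<le> \<epsilon> * (t + T)"
        using cost nt by (simp add: T_def t_def max_def split: if_splits)
      also have "\<dots> \<le> \<epsilon> * (2 * t)" using Tt eps(1) by (intro mult_left_mono) auto
      also have "\<dots> \<le> \<eta> * t"
        using mult_right_mono[OF eta(1), of t] by (simp add: mult_ac)
      finally have "B \<in> H t"
        using sd B(2,3) BN Tt by (auto simp: H_def cheap_def T_def)
      \<comment> \<open>Saturation is what confines the rest of \<open>A\<close> to
        \<open>half_old B\<close>.\<close>
      moreover have "A - B \<in> compl B"
        using B(4) A(2) card_mono[OF finA, of "A - B"] by (auto simp: compl_def)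
      moreover have "A = B \<union> (A - B)" using B(1) by blast
      ultimately have "A \<in> (\<Union>B\<in>H t. (\<union>) B ` compl B)" by blast
      then have "A \<in> X2 t" using False A by (simp add: X2_def t_def)
      moreover have "n \<le> 4 * \<Delta> * t"
        using nt mult_le_mono[of 1 "4 * \<Delta>" n t] Delta_pos by simp
      ultimately show ?thesis by (intro exI[of _ t]) (auto simp: X_def)
    qed
  qed
qed

end

section \<open>Union bound over containers\<close>

lemma prob_colors_selected:
  assumes "finite I" "Y \<subseteq> I" "0 \<le> p" "p \<le> 1"
  shows "measure_pmf.prob (Pi_pmf I False (\<lambda>_. bernoulli_pmf p)) {b. \<forall>x\<in>Y. b x} = p ^ card Y"
proof -
  have "{b. \<forall>x\<in>Y. b x} = Pi I (\<lambda>x. if x \<in> Y then {True} else UNIV)"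
    using assms(2) by (auto simp: Pi_def split: if_splits)
  then have "measure_pmf.prob (Pi_pmf I False (\<lambda>_. bernoulli_pmf p)) {b. \<forall>x\<in>Y. b x}
      = (\<Prod>x\<in>I. measure_pmf.prob (bernoulli_pmf p) (if x \<in> Y then {True} else UNIV))"
    using measure_Pi_pmf_Pi[OF assms(1)] by simp
  also have "\<dots> = (\<Prod>x\<in>I. if x \<in> Y then p else 1)"
    using assms by (intro prod.cong) (auto simp: measure_pmf_single)
  also have "\<dots> = p ^ card Y"
    using assms by (simp add: prod.If_cases Int_absorb1)
  finally show ?thesis .
qed

text \<open>A clique on \<open>A\<close> forces every color of a container \<open>B\<close> inside
  \<open>A\<close> to be selected, an event of probability \<open>p ^ t\<close>. Level
  \<open>t\<close> then contributes at most \<open>r ^ t\<close>, and the levels from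
  \<open>m\<close> on form a geometric tail.\<close>

lemma prob_container_le:
  fixes c :: "nat set \<Rightarrow> 'c" and X :: "nat \<Rightarrow> nat set set" and p r :: real
  assumes p: "0 \<le> p" "p \<le> 1" and r: "0 \<le> r" "r < 1"
    and fin: "\<And>t. finite (X t)" and card: "\<And>t. card (X t) * p ^ t \<le> r ^ t"
    and X: "\<And>t B. B \<in> X t \<Longrightarrow> B \<subseteq> {..<N} \<and> card (c ` [B]\<^bsup>2\<^esup>) = t"
    and cover: "\<And>A. \<lbrakk>A \<subseteq> {..<N}; card A = n\<rbrakk> \<Longrightarrow> \<exists>t\<ge>m. \<exists>B\<in>X t. B \<subseteq> A"
  shows "measure_pmf.prob (random_entangled_graph N c p)
    {E. \<exists>A\<subseteq>{..<N}. card A = n \<and> clique A E} \<le> r ^ m / (1 - r)"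
proof -
  define I where "I = c ` [{..<N}]\<^bsup>2\<^esup>"
  define P where "P = Pi_pmf I False (\<lambda>_. bernoulli_pmf p)"
  define Sel where "Sel B = {b. \<forall>x\<in>c ` [B]\<^bsup>2\<^esup>. b x}" for B
  have finI: "finite I" by (simp add: I_def finite_imp_finite_nsets)
  have sub: "c ` [B]\<^bsup>2\<^esup> \<subseteq> I" if "B \<subseteq> {..<N}" for B
    unfolding I_def by (intro image_mono nsets_mono that)
  have "measure_pmf.prob (random_entangled_graph N c p)
      {E. \<exists>A\<subseteq>{..<N}. card A = n \<and> clique A E}
    = measure_pmf.prob P {b. \<exists>A\<subseteq>{..<N}. card A = n \<and> clique A (entangled_graph N c {x. b x})}"
    by (simp add: random_entangled_graph_def P_def I_def vimage_def)
  \<comment> \<open>Stopping at \<open>m + card I\<close> makes the union finite and loses nothing,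
    because no container spans more than \<open>card I\<close> colors.\<close>
  also have "\<dots> \<le> measure_pmf.prob P (\<Union>t\<in>{m..m + card I}. \<Union>B\<in>X t. Sel B)"
  proof (rule measure_pmf.finite_measure_mono)
    show "{b. \<exists>A\<subseteq>{..<N}. card A = n \<and> clique A (entangled_graph N c {x. b x})}
      \<subseteq> (\<Union>t\<in>{m..m + card I}. \<Union>B\<in>X t. Sel B)"
    proof safe
      fix b A assume A: "A \<subseteq> {..<N}" "n = card A" "clique A (entangled_graph N c {x. b x})"
      then obtain t B where t: "m \<le> t" "B \<in> X t" "B \<subseteq> A" using cover by metis
      have "card (c ` [B]\<^bsup>2\<^esup>) \<le> card I"
        using X[OF t(2)] by (intro card_mono finI sub) simp
      then have "t \<in> {m..m + card I}" using X[OF t(2)] t(1) by simp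
      moreover have "b \<in> Sel B"
        unfolding Sel_def
      proof safe
        fix e assume "e \<in> [B]\<^bsup>2\<^esup>"
        then obtain u v where "e = {u, v}" "u \<in> B" "v \<in> B" "u \<noteq> v" by (rule nsets2_E)
        then show "b (c e)"
          using A(3) t(3) by (auto simp: clique_def entangled_graph_def color_class_def)
      qed
      ultimately show "b \<in> (\<Union>t\<in>{m..m + card I}. \<Union>B\<in>X t. Sel B)" using t(2) by blast
    qed
  qed simp
  also have "\<dots> \<le> (\<Sum>t=m..m + card I. measure_pmf.prob P (\<Union>B\<in>X t. Sel B))"
    by (intro measure_pmf.finite_measure_subadditive_finite) auto
  also have "\<dots> \<le> (\<Sum>t=m..m + card I. \<Sum>B\<in>X t. measure_pmf.prob P (Sel B))"
    by (intro sum_mono measure_pmf.finite_measure_subadditive_finite fin) auto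
  also have "\<dots> = (\<Sum>t=m..m + card I. \<Sum>B\<in>X t. p ^ t)"
  proof (intro sum.cong refl)
    fix t B assume "B \<in> X t"
    then show "measure_pmf.prob P (Sel B) = p ^ t"
      using X[of B t] prob_colors_selected[OF finI sub p, of B] by (simp add: P_def Sel_def)
  qed
  also have "\<dots> \<le> (\<Sum>t=m..m + card I. r ^ t)"
    using card by (intro sum_mono) simp
  also have "\<dots> \<le> r ^ m / (1 - r)"
  proof -
    have "(1 - r) * (\<Sum>t=m..m + card I. r ^ t) = r ^ m - r ^ Suc (m + card I)"
      by (rule sum_gp_multiplied) simp
    also have "\<dots> \<le> r ^ m" using r by simp
    finally show ?thesis using r by (simp add: field_simps)
  qed
  finally show ?thesis .
qed

section \<open>From cliques of a fixed size to the clique number\<close>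

lemma clique_number_greater_imp_clique:
  assumes "y < real (clique_number N E)" "0 \<le> y"
  shows "\<exists>A\<subseteq>{..<N}. card A = nat \<lceil>y\<rceil> \<and> clique A E"
proof -
  let ?S = "{card K | K. K \<subseteq> {..<N} \<and> clique K E}"
  have "?S = card ` {K. K \<subseteq> {..<N} \<and> clique K E}" by auto
  moreover have "finite {K. K \<subseteq> {..<N} \<and> clique K E}"
    by (rule finite_subset[of _ "Pow {..<N}"]) auto
  ultimately have "finite ?S" by simp
  \<comment> \<open>The empty clique ensures that \<open>Max\<close> is taken over a nonempty set
    and hence attained.\<close>
  moreover have "card ({} :: nat set) \<in> ?S" using null_clique by blast
  ultimately have "clique_number N E \<in> ?S"
    unfolding clique_number_def by (intro Max_in) blast+
  then obtain K where K: "K \<subseteq> {..<N}" "clique K E" "clique_number N E = card K" by auto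
  have "nat \<lceil>y\<rceil> \<le> card K" using assms K(3) by linarith
  then obtain A where "A \<subseteq> K" "card A = nat \<lceil>y\<rceil>"
    using obtain_subset_with_card_n by metis
  then show ?thesis using K smaller_clique by blast
qed

text \<open>Both \<open>\<beta>\<close> and \<open>n0\<close> are fixed before \<open>n\<close>,
  \<open>N\<close> and the coloring, which gives the uniformity that the limit statement
  requires.\<close>

lemma clique_probability_bound:
  fixes p :: real and \<Delta> :: nat
  assumes p: "0 < p" "p < 1" and Delta: "1 \<le> \<Delta>"
  shows "\<exists>\<beta>::real. 0 < \<beta> \<and> (\<exists>n0::nat. \<forall>n\<ge>n0. \<forall>N>0. \<forall>c :: nat set \<Rightarrow> 'c.
    bounded_coloring \<Delta> N c \<longrightarrow> ln (real n) * ln (2 * real N) \<le> \<beta> * n \<longrightarrow>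
    measure_pmf.prob (random_entangled_graph N c p)
      {E. \<exists>A\<subseteq>{..<N}. card A = n \<and> clique A E} \<le> sqrt p ^ (n div (4 * \<Delta>)) / (1 - sqrt p))"
proof -
  \<comment> \<open>With this value \<open>exp (3 * \<eta>)\<close> is \<open>1 / sqrt p\<close>, so
    the number of containers times \<open>p ^ t\<close> is at most
    \<open>sqrt p ^ t\<close>.\<close>
  define \<eta> where "\<eta> = - ln p / 6"
  have eta: "0 < \<eta>" using p by (simp add: \<eta>_def)
  \<comment> \<open>A linear function outgrows the logarithm; this yields the threshold
    \<open>K\<close> between the two kinds of containers, and \<epsilon> is then chosen small in
    terms of \<open>K\<close>.\<close>
  have "eventually (\<lambda>x::real. ln x + 2 * \<Delta> \<le> \<eta> * x) at_top"
    using eta by real_asymp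
  then obtain K0 where K0: "\<And>x. K0 \<le> x \<Longrightarrow> ln x + 2 * \<Delta> \<le> \<eta> * x"
    by (auto simp: eventually_at_top_linorder)
  define K where "K = max 1 K0"
  define \<epsilon> where "\<epsilon> = min 1 (\<eta> / (4 * \<Delta> * K + 1))"
  have K: "1 \<le> K" "\<And>x. K \<le> x \<Longrightarrow> ln x + 2 * \<Delta> \<le> \<eta> * x"
    using K0 by (auto simp: K_def)
  have pos: "0 < 4 * \<Delta> * K + 1" using K by (simp add: add_nonneg_pos)
  have eps: "0 < \<epsilon>" "\<epsilon> \<le> 1" using eta pos by (auto simp: \<epsilon>_def)
  have "\<epsilon> \<le> \<eta> / (4 * \<Delta> * K + 1)" by (simp add: \<epsilon>_def)
  then have eps': "\<epsilon> * (4 * \<Delta> * K + 1) \<le> \<eta>" using pos by (simp add: pos_le_divide_eq)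
  have "eventually (\<lambda>n::nat. 2 * \<Delta> \<le> n) at_top" by (rule eventually_ge_at_top)
  moreover have "eventually (\<lambda>n::nat. 1 \<le> ln (real n)) at_top" by real_asymp
  moreover have "eventually (\<lambda>n::nat. 1 \<le> \<epsilon> * n / (8 * ln n)) at_top"
    using eps by real_asymp
  moreover have "eventually (\<lambda>n::nat. 2 * (real n + 1)\<^sup>2 \<le> exp (\<eta> * n / (4 * \<Delta>))) at_top"
    using eta Delta by real_asymp
  ultimately have "eventually (\<lambda>n::nat. 2 * \<Delta> \<le> n \<and> 1 \<le> ln (real n) \<and> 1 \<le> \<epsilon> * n / (8 * ln n) \<and>
    2 * (real n + 1)\<^sup>2 \<le> exp (\<eta> * n / (4 * \<Delta>))) at_top"
    by eventually_elim blast
  then obtain n0 where n0: "\<And>n. n0 \<le> n \<Longrightarrow> 2 * \<Delta> \<le> n \<and> 1 \<le> ln (real n) \<and> 1 \<le> \<epsilon> * n / (8 * ln n) \<and>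
    2 * (real n + 1)\<^sup>2 \<le> exp (\<eta> * n / (4 * \<Delta>))"
    by (auto simp: eventually_at_top_linorder)
  show ?thesis
  proof (intro exI[of _ "\<epsilon>\<^sup>2 / (64 * \<Delta>)"] exI[of _ n0] conjI allI impI)
    show "0 < \<epsilon>\<^sup>2 / (64 * \<Delta>)" using eps Delta by simp
    fix n N :: nat and c :: "nat set \<Rightarrow> 'c"
    assume n: "n0 \<le> n" and N: "0 < N" "ln (real n) * ln (2 * real N) \<le> \<epsilon>\<^sup>2 / (64 * \<Delta>) * n"
      and c: "bounded_coloring \<Delta> N c"
    interpret bounded_edge_coloring N \<Delta> c
      using c Delta by unfold_locales
    obtain X :: "nat \<Rightarrow> nat set set" where X: "\<And>t. finite (X t)" "\<And>t. card (X t) \<le> exp (3 * \<eta> * t)"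
      "\<And>t B. B \<in> X t \<Longrightarrow> B \<subseteq> {..<N} \<and> card (colors B) = t"
      "\<And>A. \<lbrakk>A \<subseteq> {..<N}; card A = n\<rbrakk> \<Longrightarrow> \<exists>t. n \<le> 4 * \<Delta> * t \<and> (\<exists>B\<in>X t. B \<subseteq> A)"
      using containers_exist[OF eps eps' K, of n] n0[OF n] N by blast
    show "measure_pmf.prob (random_entangled_graph N c p)
      {E. \<exists>A\<subseteq>{..<N}. card A = n \<and> clique A E} \<le> sqrt p ^ (n div (4 * \<Delta>)) / (1 - sqrt p)"
    proof (rule prob_container_le[of p _ X])
      show "0 \<le> p" "p \<le> 1" "0 \<le> sqrt p" "sqrt p < 1" using p by auto
      show "finite (X t)" for t by (rule X(1))
      show "card (X t) * p ^ t \<le> sqrt p ^ t" for t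
      proof -
        have "ln p = 2 * ln (sqrt p)" using p by (simp add: ln_sqrt)
        then have "exp (3 * \<eta>) = exp (- ln (sqrt p))" by (simp add: \<eta>_def)
        also have "\<dots> = inverse (sqrt p)" using p by (simp add: exp_minus)
        finally have "exp (3 * \<eta>) * p = inverse (sqrt p) * (sqrt p * sqrt p)"
          using p by simp
        then have "exp (3 * \<eta>) * p = sqrt p"
          using p by (simp del: real_sqrt_mult_self)
        moreover have "exp (3 * \<eta> * t) = exp (3 * \<eta>) ^ t"
          by (metis exp_of_nat_mult mult.commute)
        ultimately have "exp (3 * \<eta> * t) * p ^ t = sqrt p ^ t"
          by (simp flip: power_mult_distrib)
        then show ?thesis using X(2)[of t] p by (metis mult_right_mono zero_le_power less_imp_le)
      qed
      show "B \<subseteq> {..<N} \<and> card (c ` [B]\<^bsup>2\<^esup>) = t" if "B \<in> X t" for t B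
        using X(3)[OF that] by (simp add: colors_def)
      show "\<exists>t\<ge>n div (4 * \<Delta>). \<exists>B\<in>X t. B \<subseteq> A" if A: "A \<subseteq> {..<N}" "card A = n" for A
      proof -
        obtain t where t: "n \<le> 4 * \<Delta> * t" "\<exists>B\<in>X t. B \<subseteq> A" using X(4)[OF A] by blast
        have "n div (4 * \<Delta>) \<le> (4 * \<Delta> * t) div (4 * \<Delta>)" using t(1) by (rule div_le_mono)
        then have "n div (4 * \<Delta>) \<le> t" using Delta by simp
        then show ?thesis using t(2) by blast
      qed
    qed
  qed
qed

theorem theorem1p3:
  fixes \<Delta> :: nat and p :: real
  assumes "0 < p" and "p < 1"
  shows "\<exists>C::real. \<forall>\<epsilon>>0. \<exists>N\<^sub>0. \<forall>N\<ge>N\<^sub>0. \<forall>c :: nat set \<Rightarrow> 'c.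
           bounded_coloring \<Delta> N c \<longrightarrow>
           measure_pmf.prob (random_entangled_graph N c p)
             {E. real (clique_number N E) \<le> C * ln (real N) * ln (ln (real N))} \<ge> 1 - \<epsilon>"
proof -
  \<comment> \<open>Covers \<open>\<Delta> = 0\<close>: boundedness passes to the larger
    \<open>D\<close>, which is at least 1 as the preceding lemmas demand.\<close>
  define D where "D = max 1 \<Delta>"
  have D: "1 \<le> D" by (simp add: D_def)
  obtain \<beta> :: real and n0 where \<beta>: "\<beta> > 0" and bound: "\<And>(n :: nat) N (c :: nat set \<Rightarrow> 'c). \<lbrakk>n0 \<le> n; 0 < N;
      bounded_coloring D N c; ln (real n) * ln (2 * real N) \<le> \<beta> * n\<rbrakk> \<Longrightarrow>
    measure_pmf.prob (random_entangled_graph N c p)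
      {E. \<exists>A\<subseteq>{..<N}. card A = n \<and> clique A E} \<le> sqrt p ^ (n div (4 * D)) / (1 - sqrt p)"
    using clique_probability_bound[OF assms D] by blast
  \<comment> \<open>For large \<open>N\<close>, \<open>ln n <= 2 * ln (ln N)\<close> and
    \<open>ln (2 * N) <= 2 * ln N\<close>; the product of the two bounds is exactly
    \<open>\<beta> * y N\<close> for this \<open>C\<close>.\<close>
  define C where "C = 4 / \<beta>"
  have C: "0 < C" using \<beta> by (simp add: C_def)
  define y where "y N = C * ln (real N) * ln (ln (real N))" for N :: nat
  have y: "filterlim y at_top at_top"
    unfolding y_def using C by real_asymp
  have ev1: "eventually (\<lambda>N::nat. ln (C * ln (real N) * ln (ln (real N)) + 1) \<le> 2 * ln (ln (real N))) at_top"
    using C by real_asymp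
  have ev2: "eventually (\<lambda>N::nat. ln (2 * real N) \<le> 2 * ln (real N)) at_top"
    by real_asymp
  show ?thesis
  proof (rule exI[of _ C], intro allI impI)
    fix \<epsilon> :: real assume \<epsilon>: "\<epsilon> > 0"
    have "(\<lambda>m. sqrt p ^ m / (1 - sqrt p)) \<longlonglongrightarrow> 0 / (1 - sqrt p)"
      using assms by (intro tendsto_divide LIMSEQ_realpow_zero tendsto_const) auto
    then have "eventually (\<lambda>m. sqrt p ^ m / (1 - sqrt p) < \<epsilon>) at_top"
      using \<epsilon> by (intro order_tendstoD(2)) auto
    then obtain m0 where m0: "\<And>m. m0 \<le> m \<Longrightarrow> sqrt p ^ m / (1 - sqrt p) < \<epsilon>"
      by (auto simp: eventually_at_top_linorder)
    \<comment> \<open>Guarantees both \<open>n >= n0\<close> and \<open>n div (4 * D) >= m0\<close>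
      for the rounded value \<open>n\<close> below.\<close>
    have "eventually (\<lambda>N. real (n0 + m0 * (4 * D) + 1) \<le> y N) at_top"
      using y by (simp add: filterlim_at_top)
    with ev1 ev2 eventually_gt_at_top[of 0]
    have "eventually (\<lambda>N. \<forall>c :: nat set \<Rightarrow> 'c. bounded_coloring \<Delta> N c \<longrightarrow>
           measure_pmf.prob (random_entangled_graph N c p)
             {E. real (clique_number N E) \<le> C * ln (real N) * ln (ln (real N))} \<ge> 1 - \<epsilon>) at_top"
    proof eventually_elim
      case (elim N)
      define n where "n = nat \<lceil>y N\<rceil>"
      have n: "y N \<le> n" "n \<le> y N + 1" "n0 + m0 * (4 * D) + 1 \<le> n"
        using elim(4) unfolding n_def by linarith+
      have "ln (real n) \<le> ln (y N + 1)"
        using n by (subst ln_le_cancel_iff) auto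
      then have ln_n: "ln (real n) \<le> 2 * ln (ln (real N))"
        using elim(1) by (simp add: y_def)
      have "ln (real n) * ln (2 * real N) \<le> (2 * ln (ln (real N))) * (2 * ln (real N))"
      proof (intro mult_mono ln_n elim(2))
        have "0 \<le> ln (real n)" using n(3) by simp
        then show "0 \<le> 2 * ln (ln (real N))" using ln_n by linarith
        show "0 \<le> ln (2 * real N)" using elim(3) by simp
      qed
      also have "\<dots> = \<beta> * y N" using \<beta> by (simp add: y_def C_def)
      also have "\<dots> \<le> \<beta> * n" using \<beta> n(1) by (intro mult_left_mono) auto
      finally have cond: "ln (real n) * ln (2 * real N) \<le> \<beta> * n" by simp
      have "m0 \<le> n div (4 * D)"
        using n(3) D by (simp add: less_eq_div_iff_mult_less_eq)
      then have small: "sqrt p ^ (n div (4 * D)) / (1 - sqrt p) < \<epsilon>" by (rule m0)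
      show ?case
      proof (intro allI impI)
        fix c :: "nat set \<Rightarrow> 'c"
        assume "bounded_coloring \<Delta> N c"
        then have "bounded_coloring D N c"
          by (auto simp: bounded_coloring_def D_def intro: le_max_iff_disj[THEN iffD2])
        then have le: "measure_pmf.prob (random_entangled_graph N c p)
            {E. \<exists>A\<subseteq>{..<N}. card A = n \<and> clique A E} < \<epsilon>"
          using bound[of n N c] elim(3) cond n(3) small by simp
        let ?good = "{E. real (clique_number N E) \<le> C * ln (real N) * ln (ln (real N))}"
        have "0 \<le> y N" using elim(4) by linarith
        then have "- ?good \<subseteq> {E. \<exists>A\<subseteq>{..<N}. card A = n \<and> clique A E}"
          using clique_number_greater_imp_clique[of "y N" N] by (auto simp: n_def y_def)
        then have "measure_pmf.prob (random_entangled_graph N c p) (- ?good) < \<epsilon>"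
          by (intro le_less_trans[OF measure_pmf.finite_measure_mono le]) auto
        then show "1 - \<epsilon> \<le> measure_pmf.prob (random_entangled_graph N c p) ?good"
          using measure_pmf.prob_compl[of ?good "random_entangled_graph N c p"]
          by (simp add: Compl_eq_Diff_UNIV)
      qed
    qed
    then show "\<exists>N\<^sub>0. \<forall>N\<ge>N\<^sub>0. \<forall>c :: nat set \<Rightarrow> 'c. bounded_coloring \<Delta> N c \<longrightarrow>
           measure_pmf.prob (random_entangled_graph N c p)
             {E. real (clique_number N E) \<le> C * ln (real N) * ln (ln (real N))} \<ge> 1 - \<epsilon>"
      by (simp add: eventually_at_top_linorder)
  qed
qed

end
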